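(* Let $n\in\{2,3,4\}$ and let $(d_1,\dots,d_n)$ be an unordered sequence of $n$ positive integers. (1) For $n=2$: $(d_1,d_2)$ is a regular degree sequence if and only if it is permissible, if and only if it satisfies condition $( * )$. (2) For $n=3$: $(d_1,d_2,d_3)$ is a regular degree sequence if and only if it is permissible. (3) For $n=4$: every permissible degree sequence $(d_1,d_2,d_3,d_4)$ is a regular degree sequence, except the sequences $(1,2,5,12\delta)$, $(2,2,5,12\delta)$ and $(5,2,5,12\delta)$ with $\delta$ a positive integer, which are not regular degree sequences.
   Context: Let $R=\mathbb{C}[x_1,\dots,x_n]$ with the standard grading and let the symmetric group $\mathfrak{S}_n$ act by permuting the variables; $R^{\mathfrak{S}_n}=\mathbb{C}[e_1,\dots,e_n]$, where $e_i$ is the $i$-th elementary symmetric polynomial. A sequence of $n$ homogeneous polynomials in $R$ is a (maximal) regular sequence iff its only common zero in $\mathbb{C}^n$ is the origin. An unordered sequence $(d_1,\dots,d_n)$ of positive integers is a regular degree sequence if there exists a homogeneous regular sequence $f_1,\dots,f_n$ in $R$ with every $f_i\in R^{\mathfrak{S}_n}$ and $\deg f_i=d_i$. Condition $( * )$: for every $i=1,\dots,n$, $\beta_i:=\#\{1\le j\le n: i\mid d_j\}\ge\lfloor n/i\rfloor$. Condition $(\dagger)$: for every $i=1,\dots,n$, $\#\{j: d_j\le i\}\le i$. The sequence is permissible if it satisfies both $( * )$ and $(\dagger)$. *)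

theory Defs
  imports Complex_Main "HOL-Library.Poly_Mapping" "HOL-Combinatorics.Permutations"
begin

text \<open>Multivariate polynomials over the complex numbers in the variables x_0, x_1, ...:
  a monomial is an exponent vector (finitely supported nat to nat), a polynomial is a finitely
  supported map from monomials to coefficients.\<close>

type_synonym cpoly = "(nat \<Rightarrow>\<^sub>0 nat) \<Rightarrow>\<^sub>0 complex"

definition mpoly_eval :: "cpoly \<Rightarrow> (nat \<Rightarrow> complex) \<Rightarrow> complex" where
  "mpoly_eval p x = (\<Sum>m\<in>Poly_Mapping.keys p. Poly_Mapping.lookup p m * (\<Prod>i\<in>Poly_Mapping.keys m. x i ^ Poly_Mapping.lookup m i))"

definition mon_deg :: "(nat \<Rightarrow>\<^sub>0 nat) \<Rightarrow> nat" where
  "mon_deg m = (\<Sum>i\<in>Poly_Mapping.keys m. Poly_Mapping.lookup m i)"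

definition in_vars :: "nat \<Rightarrow> cpoly \<Rightarrow> bool" where
  "in_vars n p \<longleftrightarrow> (\<forall>m\<in>Poly_Mapping.keys p. Poly_Mapping.keys m \<subseteq> {..<n})"

definition homogeneous_of_deg :: "nat \<Rightarrow> cpoly \<Rightarrow> bool" where
  "homogeneous_of_deg d p \<longleftrightarrow> p \<noteq> 0 \<and> (\<forall>m\<in>Poly_Mapping.keys p. mon_deg m = d)"

definition symmetric_poly :: "nat \<Rightarrow> cpoly \<Rightarrow> bool" where
  "symmetric_poly n p \<longleftrightarrow>
     (\<forall>\<sigma>. \<sigma> permutes {..<n} \<longrightarrow> (\<forall>x. mpoly_eval p (x \<circ> \<sigma>) = mpoly_eval p x))"

text \<open>Homogeneous f_0..f_{n-1} in R form a regular sequence iff their only common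
  zero in C^n is the origin.\<close>
definition only_common_zero_origin :: "nat \<Rightarrow> cpoly list \<Rightarrow> bool" where
  "only_common_zero_origin n fs \<longleftrightarrow>
     (\<forall>x::nat \<Rightarrow> complex. (\<forall>f\<in>set fs. mpoly_eval f x = 0) \<longrightarrow> (\<forall>i<n. x i = 0))"

text \<open>Degree sequences are lists (of length n); all notions are invariant under reordering.\<close>
definition regular_degree_sequence :: "nat list \<Rightarrow> bool" where
  "regular_degree_sequence ds \<longleftrightarrow>
     (let n = length ds in
      \<exists>fs :: cpoly list. length fs = n \<and>
        (\<forall>j<n. in_vars n (fs ! j) \<and> symmetric_poly n (fs ! j) \<and>
                homogeneous_of_deg (ds ! j) (fs ! j)) \<and>
        only_common_zero_origin n fs)"

definition cond_star :: "nat list \<Rightarrow> bool" where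
  "cond_star ds \<longleftrightarrow> (let n = length ds in
     \<forall>i\<in>{1..n}. card {j. j < n \<and> i dvd ds ! j} \<ge> n div i)"

definition cond_dagger :: "nat list \<Rightarrow> bool" where
  "cond_dagger ds \<longleftrightarrow> (let n = length ds in
     \<forall>i\<in>{1..n}. card {j. j < n \<and> ds ! j \<le> i} \<le> i)"

definition permissible :: "nat list \<Rightarrow> bool" where
  "permissible ds \<longleftrightarrow> cond_star ds \<and> cond_dagger ds"

definition exceptional4 :: "nat list \<Rightarrow> bool" where
  "exceptional4 ds \<longleftrightarrow> (\<exists>\<delta>::nat. \<delta> > 0 \<and>
     (mset ds = {#1, 2, 5, 12 * \<delta>#} \<or> mset ds = {#2, 2, 5, 12 * \<delta>#} \<or>
      mset ds = {#5, 2, 5, 12 * \<delta>#}))"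

end

theory Submission
  imports Defs "HOL-Computational_Algebra.Fundamental_Theorem_Algebra"
begin

text \<open>The power sums \<open>p\<^sub>1, \<dots>, p\<^sub>n\<close> have only the origin as a common zero, so it suffices to find
  weighted homogeneous polynomials in them, \<open>p\<^sub>k\<close> having weight \<open>k\<close>, that force all
  \<open>p\<^sub>k\<close> to vanish. If distinct degrees can be chosen divisible by \<open>1, \<dots>, n\<close>, powers of
  the \<open>p\<^sub>k\<close> do. Otherwise one degree has to serve twice, and a sum such as
  \<open>p\<^sub>3\<^bsup>4d\<^esup> + p\<^sub>4\<^bsup>3d\<^esup>\<close> in degree \<open>12d\<close> meets a monomial
  that vanishes exactly when \<open>p\<^sub>3\<close> or \<open>p\<^sub>4\<close> does.

  Conversely, at the point whose coordinates are the \<open>k\<close>-th roots of unity padded with zeros,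
  every symmetric form of degree not divisible by \<open>k\<close> vanishes. In the exceptional case
  \<open>n = 4\<close>, symmetric forms of degree 1, 2 and 5 vanish on the conic \<open>p\<^sub>1 = p\<^sub>2 = 0\<close>,
  because neither 1, 2 nor 5 is a sum of 3s and 4s. The conic is rational, so the remaining
  form restricts to a binary form on it, which has a nontrivial zero.\<close>

section \<open>Evaluation of polynomials\<close>

definition mon_eval :: "(nat \<Rightarrow>\<^sub>0 nat) \<Rightarrow> (nat \<Rightarrow> complex) \<Rightarrow> complex" where
  "mon_eval m x = (\<Prod>i\<in>Poly_Mapping.keys m. x i ^ Poly_Mapping.lookup m i)"

text \<open>Padding to a common finite index set lets monomials with different supports be combined
  factor by factor.\<close>

lemma mon_eval_superset:
  assumes "finite S" "Poly_Mapping.keys m \<subseteq> S"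
  shows "mon_eval m x = (\<Prod>i\<in>S. x i ^ Poly_Mapping.lookup m i)"
  unfolding mon_eval_def using assms
  by (intro prod.mono_neutral_left) (auto simp: in_keys_iff)

lemma mon_deg_superset:
  assumes "finite S" "Poly_Mapping.keys m \<subseteq> S"
  shows "mon_deg m = (\<Sum>i\<in>S. Poly_Mapping.lookup m i)"
  unfolding mon_deg_def using assms
  by (intro sum.mono_neutral_left) (auto simp: in_keys_iff)

lemma mon_eval_add: "mon_eval (m + m') x = mon_eval m x * mon_eval m' x"
proof -
  let ?S = "Poly_Mapping.keys m \<union> Poly_Mapping.keys m'"
  show ?thesis
    using mon_eval_superset[of ?S m x] mon_eval_superset[of ?S m' x]
      mon_eval_superset[of ?S "m + m'" x] keys_add[of m m']
    by (simp add: lookup_add power_add prod.distrib)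
qed

lemma mon_deg_add: "mon_deg (m + m') = mon_deg m + mon_deg m'"
proof -
  let ?S = "Poly_Mapping.keys m \<union> Poly_Mapping.keys m'"
  show ?thesis
    using mon_deg_superset[of ?S m] mon_deg_superset[of ?S m']
      mon_deg_superset[of ?S "m + m'"] keys_add[of m m']
    by (simp add: lookup_add sum.distrib)
qed

lemma mpoly_eval_alt:
  "mpoly_eval p x = (\<Sum>m\<in>Poly_Mapping.keys p. Poly_Mapping.lookup p m * mon_eval m x)"
  by (simp add: mpoly_eval_def mon_eval_def)

lemma mpoly_eval_superset:
  assumes "finite S" "Poly_Mapping.keys p \<subseteq> S"
  shows "mpoly_eval p x = (\<Sum>m\<in>S. Poly_Mapping.lookup p m * mon_eval m x)"
  unfolding mpoly_eval_alt using assms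
  by (intro sum.mono_neutral_left) (auto simp: in_keys_iff)

lemma mpoly_eval_0 [simp]: "mpoly_eval 0 x = 0"
  by (simp add: mpoly_eval_alt)

lemma mpoly_eval_single: "mpoly_eval (Poly_Mapping.single m c) x = c * mon_eval m x"
  by (simp add: mpoly_eval_alt)

lemma mpoly_eval_1 [simp]: "mpoly_eval 1 x = 1"
  using mpoly_eval_single[of 0 1 x] by (simp add: mon_eval_def)

lemma mpoly_eval_add: "mpoly_eval (p + q) x = mpoly_eval p x + mpoly_eval q x"
proof -
  let ?S = "Poly_Mapping.keys p \<union> Poly_Mapping.keys q"
  show ?thesis
    using mpoly_eval_superset[of ?S p x] mpoly_eval_superset[of ?S q x]
      mpoly_eval_superset[of ?S "p + q" x] keys_add[of p q]
    by (simp add: lookup_add sum.distrib algebra_simps)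
qed

lemma mpoly_eval_sum: "mpoly_eval (sum f A) x = (\<Sum>i\<in>A. mpoly_eval (f i) x)"
  by (induction A rule: infinite_finite_induct) (auto simp: mpoly_eval_add)

text \<open>By bilinearity, this decomposition reduces the evaluation of a product to the case of
  monomials.\<close>

lemma cpoly_eq_sum_single:
  "(p :: cpoly) = (\<Sum>m\<in>Poly_Mapping.keys p. Poly_Mapping.single m (Poly_Mapping.lookup p m))"
proof (rule poly_mapping_eqI)
  fix k
  have "(\<Sum>m\<in>Poly_Mapping.keys p. Poly_Mapping.lookup
          (Poly_Mapping.single m (Poly_Mapping.lookup p m)) k) =
        (\<Sum>m\<in>Poly_Mapping.keys p. if m = k then Poly_Mapping.lookup p m else 0)"
    by (intro sum.cong) (auto simp: lookup_single)
  also have "\<dots> = Poly_Mapping.lookup p k"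
    by (simp add: in_keys_iff)
  finally show "Poly_Mapping.lookup p k = Poly_Mapping.lookup
      (\<Sum>m\<in>Poly_Mapping.keys p. Poly_Mapping.single m (Poly_Mapping.lookup p m)) k"
    by (simp add: lookup_sum)
qed

lemma mpoly_eval_mult: "mpoly_eval (p * q) x = mpoly_eval p x * mpoly_eval q x"
proof -
  have "p * q = (\<Sum>m\<in>Poly_Mapping.keys p. \<Sum>m'\<in>Poly_Mapping.keys q.
      Poly_Mapping.single (m + m') (Poly_Mapping.lookup p m * Poly_Mapping.lookup q m'))"
    by (subst (1) cpoly_eq_sum_single[of p], subst (1) cpoly_eq_sum_single[of q])
      (simp add: sum_product mult_single)
  then have "mpoly_eval (p * q) x = (\<Sum>m\<in>Poly_Mapping.keys p. \<Sum>m'\<in>Poly_Mapping.keys q.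
      Poly_Mapping.lookup p m * Poly_Mapping.lookup q m' * (mon_eval m x * mon_eval m' x))"
    by (simp add: mpoly_eval_sum mpoly_eval_single mon_eval_add)
  then show ?thesis
    by (simp add: mpoly_eval_alt sum_product mult_ac)
qed

lemma mpoly_eval_power: "mpoly_eval (p ^ k) x = mpoly_eval p x ^ k"
  by (induction k) (auto simp: mpoly_eval_mult)

text \<open>Used with a root of unity as \<open>c\<close>, and to see that restricting a form to a
  homogeneously parametrised curve gives a homogeneous function.\<close>

lemma mpoly_eval_scale:
  assumes "\<forall>m\<in>Poly_Mapping.keys p. mon_deg m = d"
  shows "mpoly_eval p (\<lambda>i. c * x i) = c ^ d * mpoly_eval p x"
proof -
  have "mon_eval m (\<lambda>i. c * x i) = c ^ mon_deg m * mon_eval m x" for m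
    by (simp add: mon_eval_def mon_deg_def power_mult_distrib prod.distrib power_sum)
  then show ?thesis
    using assms by (simp add: mpoly_eval_alt sum_distrib_left algebra_simps)
qed

text \<open>Makes the fundamental theorem of algebra applicable to forms restricted to a
  parametrised curve.\<close>

lemma mpoly_eval_poly:
  fixes X :: "nat \<Rightarrow> complex poly"
  shows "\<exists>P. \<forall>t. mpoly_eval p (\<lambda>i. poly (X i) t) = poly P t"
  by (rule exI[of _ "\<Sum>m\<in>Poly_Mapping.keys p. [:Poly_Mapping.lookup p m:] *
        (\<Prod>i\<in>Poly_Mapping.keys m. X i ^ Poly_Mapping.lookup m i)"])
     (simp add: mpoly_eval_def poly_sum poly_prod)

section \<open>Symmetric forms\<close>

text \<open>Unlike \<^const>\<open>homogeneous_of_deg\<close>, this admits the zero polynomial and is thus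
  closed under sums.\<close>

definition symmetric_form :: "nat \<Rightarrow> nat \<Rightarrow> cpoly \<Rightarrow> bool" where
  "symmetric_form n d f \<longleftrightarrow> in_vars n f \<and> symmetric_poly n f \<and>
     (\<forall>m\<in>Poly_Mapping.keys f. mon_deg m = d)"

lemma symmetric_form_add:
  assumes "symmetric_form n d f" "symmetric_form n d g"
  shows "symmetric_form n d (f + g)"
  using assms keys_add[of f g] unfolding symmetric_form_def in_vars_def symmetric_poly_def
  by (auto simp: mpoly_eval_add subset_iff)

lemma symmetric_form_mult:
  assumes "symmetric_form n d f" "symmetric_form n e g"
  shows "symmetric_form n (d + e) (f * g)"
proof -
  have "\<exists>a b. m = a + b \<and> a \<in> Poly_Mapping.keys f \<and> b \<in> Poly_Mapping.keys g"
    if "m \<in> Poly_Mapping.keys (f * g)" for m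
    using that keys_mult[of f g] by blast
  moreover have "Poly_Mapping.keys (a + b) \<subseteq> {..<n}"
    if "a \<in> Poly_Mapping.keys f" "b \<in> Poly_Mapping.keys g" for a b
    using that assms keys_add[of a b] unfolding symmetric_form_def in_vars_def by blast
  ultimately show ?thesis
    using assms unfolding symmetric_form_def in_vars_def symmetric_poly_def
    by (simp add: mpoly_eval_mult) (metis mon_deg_add)
qed

lemma symmetric_form_power:
  assumes "symmetric_form n d f"
  shows "symmetric_form n (d * k) (f ^ k)"
proof (induction k)
  case 0
  have "symmetric_form n 0 1"
    by (auto simp: symmetric_form_def in_vars_def symmetric_poly_def mon_deg_def)
  then show ?case by simp
qed (use symmetric_form_mult[OF assms] in simp)

definition power_sum :: "nat \<Rightarrow> nat \<Rightarrow> cpoly" where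
  "power_sum n k = (\<Sum>i<n. Poly_Mapping.single (Poly_Mapping.single i k) 1)"

lemma mpoly_eval_power_sum: "mpoly_eval (power_sum n k) x = (\<Sum>i<n. x i ^ k)"
proof -
  have "mon_eval (Poly_Mapping.single i k) x = x i ^ k" for i
    by (cases "k = 0") (simp_all add: mon_eval_def)
  then show ?thesis
    unfolding power_sum_def mpoly_eval_sum mpoly_eval_single by simp
qed

lemma keys_sum_subset:
  "Poly_Mapping.keys (\<Sum>i\<in>A. f i) \<subseteq> (\<Union>i\<in>A. Poly_Mapping.keys (f i))"
proof (induction A rule: infinite_finite_induct)
  case (insert a A)
  then show ?case using keys_add[of "f a" "sum f A"] by auto
qed auto

lemma symmetric_form_power_sum: "symmetric_form n k (power_sum n k)"
proof -
  have *: "\<exists>i<n. m = Poly_Mapping.single i k" if "m \<in> Poly_Mapping.keys (power_sum n k)" for m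
    using that keys_sum_subset[of "\<lambda>i. Poly_Mapping.single (Poly_Mapping.single i k) (1::complex)" "{..<n}"]
    unfolding power_sum_def by auto
  have "symmetric_poly n (power_sum n k)"
    unfolding symmetric_poly_def mpoly_eval_power_sum
  proof (intro allI impI)
    fix \<sigma> and x :: "nat \<Rightarrow> complex"
    assume "\<sigma> permutes {..<n}"
    then show "(\<Sum>i<n. (x \<circ> \<sigma>) i ^ k) = (\<Sum>i<n. x i ^ k)"
      using sum.permute[of \<sigma> "{..<n}" "\<lambda>i. x i ^ k"] by (simp add: comp_def)
  qed
  moreover have "mon_deg (Poly_Mapping.single i k) = k" for i
    by (simp add: mon_deg_def)
  ultimately show ?thesis
    unfolding symmetric_form_def in_vars_def using * by (fastforce split: if_splits)
qed

text \<open>Averaging over the symmetric group: \<open>f\<close> is its own mean over all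
  permutations, so it vanishes at \<open>x\<close> as soon as the orbit sum of every monomial of
  degree \<open>d\<close> does. This avoids expressing \<open>f\<close> through generators of the
  invariant ring.\<close>

lemma symmetric_form_sum_permutes:
  assumes f: "symmetric_form n d f"
    and vanish: "\<And>a. (\<Sum>i<n. a i) = d \<Longrightarrow> (\<Sum>\<sigma>\<in>{\<sigma>. \<sigma> permutes {..<n}}. \<Prod>i<n. x (\<sigma> i) ^ a i) = 0"
  shows "mpoly_eval f x = 0"
proof -
  have *: "Poly_Mapping.keys m \<subseteq> {..<n} \<and> (\<Sum>i<n. Poly_Mapping.lookup m i) = d"
    if "m \<in> Poly_Mapping.keys f" for m
    using f that mon_deg_superset[of "{..<n}" m] by (auto simp: symmetric_form_def in_vars_def)
  have "of_nat (fact n) * mpoly_eval f x = (\<Sum>\<sigma>\<in>{\<sigma>. \<sigma> permutes {..<n}}. mpoly_eval f (x \<circ> \<sigma>))"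
    using f by (simp add: symmetric_form_def symmetric_poly_def card_permutations)
  also have "\<dots> = (\<Sum>m\<in>Poly_Mapping.keys f. Poly_Mapping.lookup f m *
      (\<Sum>\<sigma>\<in>{\<sigma>. \<sigma> permutes {..<n}}. \<Prod>i<n. x (\<sigma> i) ^ Poly_Mapping.lookup m i))"
    unfolding mpoly_eval_alt sum_distrib_left
    by (subst sum.swap) (intro sum.cong refl, simp add: mon_eval_superset[of "{..<n}"] *)
  also have "\<dots> = 0"
    using * vanish by (intro sum.neutral) auto
  finally show ?thesis by simp
qed

section \<open>Regular sequences\<close>

lemma power_sums_eq_0_imp_eq_0:
  fixes x :: "nat \<Rightarrow> complex"
  assumes "\<And>k. 1 \<le> k \<Longrightarrow> k \<le> n \<Longrightarrow> (\<Sum>i<n. x i ^ k) = 0" "j < n"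
  shows "x j = 0"
proof (rule ccontr)
  assume xj: "x j \<noteq> 0"
  text \<open>A polynomial without constant term whose value on the \<^term>\<open>x i\<close> is the indicator of
    \<^term>\<open>x j\<close>, up to a nonzero factor.\<close>
  define V where "V = x ` {..<n} - {0, x j}"
  define g where "g = [:0, 1:] * (\<Prod>v\<in>V. [:- v, 1:])"
  have fin: "finite V" by (simp add: V_def)
  \<comment> \<open>\<open>V\<close> misses the value \<open>x j\<close>, so it has fewer than
    \<open>n\<close> elements and \<open>g\<close> has degree at most \<open>n\<close>: only the
    first \<open>n\<close> power sums enter.\<close>
  have "card V < card (x ` {..<n})"
    unfolding V_def using assms(2) by (intro psubset_card_mono) auto
  also have "\<dots> \<le> n" using card_image_le[of "{..<n}" x] by simp
  finally have "card V < n" .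
  moreover have "degree (\<Prod>v\<in>V. [:- v, 1:]) \<le> (\<Sum>v\<in>V. degree [:- v, 1:])"
    using degree_prod_sum_le[OF fin, of "\<lambda>v. [:- v, 1:]"] by (simp add: comp_def)
  ultimately have deg: "degree g \<le> n"
    unfolding g_def using degree_mult_le[of "[:0, 1:]" "\<Prod>v\<in>V. [:- v, 1:]"] by simp
  have g: "poly g z = z * (\<Prod>v\<in>V. z - v)" for z
    by (simp add: g_def poly_prod)
  have g_sum: "poly g z = (\<Sum>k\<le>n. coeff g k * z ^ k)" for z
    unfolding poly_altdef using deg by (intro sum.mono_neutral_left) (auto intro: coeff_eq_0)
  have "(\<Sum>i<n. poly g (x i)) = (\<Sum>k\<le>n. coeff g k * (\<Sum>i<n. x i ^ k))"
    unfolding g_sum sum_distrib_left by (rule sum.swap)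
  also have "\<dots> = 0"
  proof (intro sum.neutral ballI)
    \<comment> \<open>The factor \<open>[:0, 1:]\<close> removes the constant term, where the power
      sum would be \<open>n\<close> instead of 0.\<close>
    fix k assume "k \<in> {..n}"
    then show "coeff g k * (\<Sum>i<n. x i ^ k) = 0"
      using assms(1)[of k] by (cases "k = 0") (auto simp: g_def)
  qed
  \<comment> \<open>Only indices with \<open>x i = x j\<close> survive, so the sum is the
    multiplicity of \<open>x j\<close> times \<open>poly g (x j)\<close>.\<close>
  also have "(\<Sum>i<n. poly g (x i)) = (\<Sum>i\<in>{i\<in>{..<n}. x i = x j}. poly g (x j))"
  proof (rule sum.mono_neutral_cong_right)
    show "\<forall>i\<in>{..<n} - {i \<in> {..<n}. x i = x j}. poly g (x i) = 0"
      using fin by (auto simp: g V_def)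
  qed auto
  finally have "card {i\<in>{..<n}. x i = x j} = 0 \<or> poly g (x j) = 0"
    by simp
  moreover have "poly g (x j) \<noteq> 0"
    using xj fin by (auto simp: g V_def)
  ultimately show False
    using assms(2) by auto
qed

text \<open>The premise at the first unit vector certifies that no form is the zero polynomial. It
  is easy to check for sums of products of power sums, since each power sum of positive weight takes
  the value 1 there.\<close>

lemma regular_degree_sequenceI:
  assumes form: "list_all2 (symmetric_form n) ds fs" and n: "length ds = n"
    and nz: "\<forall>f\<in>set fs. mpoly_eval f (\<lambda>i. if i = 0 then 1 else 0) \<noteq> 0"
    and zero: "\<And>x k. \<forall>f\<in>set fs. mpoly_eval f x = 0 \<Longrightarrow> 1 \<le> k \<Longrightarrow> k \<le> n \<Longrightarrow>
            mpoly_eval (power_sum n k) x = 0"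
  shows "regular_degree_sequence ds"
proof -
  have len: "length fs = n"
    using form n list_all2_lengthD by force
  have "f \<noteq> 0" if "f \<in> set fs" for f
    using nz that by fastforce
  then have "homogeneous_of_deg (ds ! j) (fs ! j) \<and> symmetric_form n (ds ! j) (fs ! j)" if "j < n" for j
    using that len n list_all2_nthD[OF form, of j]
    by (auto simp: symmetric_form_def homogeneous_of_deg_def)
  moreover have "only_common_zero_origin n fs"
    unfolding only_common_zero_origin_def
    using zero power_sums_eq_0_imp_eq_0[of n] by (simp add: mpoly_eval_power_sum)
  ultimately show ?thesis
    unfolding regular_degree_sequence_def Let_def n using len
    by (intro exI[of _ fs]) (auto simp: symmetric_form_def)
qed

text \<open>Reordering the forms along with the degrees allows constructions and obstructions to be
  stated in one fixed order.\<close>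

lemma regular_degree_sequence_mset:
  assumes "regular_degree_sequence ds" "mset ds = mset ds'"
  shows "regular_degree_sequence ds'"
proof -
  let ?n = "length ds"
  obtain fs where fs: "length fs = ?n" "only_common_zero_origin ?n fs"
    "\<And>j. j < ?n \<Longrightarrow> in_vars ?n (fs ! j) \<and> symmetric_poly ?n (fs ! j) \<and>
      homogeneous_of_deg (ds ! j) (fs ! j)"
    using assms(1) unfolding regular_degree_sequence_def Let_def by blast
  have len: "length ds' = ?n"
    using assms(2) by (metis size_mset)
  obtain p where p: "p permutes {..<?n}" "permute_list p ds = ds'"
    using mset_eq_permutation[OF assms(2)[symmetric]] by blast
  have "p j < ?n" if "j < ?n" for j
    using permutes_in_image[OF p(1), of j] that by simp
  then show ?thesis
    unfolding regular_degree_sequence_def Let_def len using fs p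
    by (intro exI[of _ "permute_list p fs"])
      (auto simp: permute_list_nth only_common_zero_origin_def set_permute_list)
qed

section \<open>Obstructions\<close>

text \<open>A cyclic shift of the first \<open>k\<close> coordinates multiplies the point
  \<open>x\<close> below by a primitive \<open>k\<close>-th root of unity \<zeta>. A symmetric form
  of degree \<open>d\<close> thus satisfies f(x) = \<zeta>^d f(x), which forces f(x) = 0 unless
  \<open>k\<close> divides \<open>d\<close>.\<close>

lemma regular_degree_sequence_dvd:
  assumes "regular_degree_sequence ds" "k \<ge> 1" "k \<le> length ds"
  shows "\<exists>d\<in>set ds. k dvd d"
proof (rule ccontr)
  assume no: "\<not> ?thesis"
  let ?n = "length ds"
  obtain fs where fs: "length fs = ?n" "only_common_zero_origin ?n fs"
    "\<And>j. j < ?n \<Longrightarrow> symmetric_form ?n (ds ! j) (fs ! j)"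
    using assms(1) unfolding regular_degree_sequence_def Let_def symmetric_form_def
      homogeneous_of_deg_def by blast
  define \<zeta> where "\<zeta> = cis (2 * pi / real k)"
  have \<zeta>_pow: "\<zeta> ^ j = cis (2 * pi * real j / real k)" for j
    by (simp add: \<zeta>_def DeMoivre mult.commute)
  have \<zeta>k: "\<zeta> ^ k = 1"
    using assms(2) by (simp add: \<zeta>_pow)
  have \<zeta>d: "\<zeta> ^ d \<noteq> 1" if "\<not> k dvd d" for d
  proof
    assume "\<zeta> ^ d = 1"
    moreover have "\<zeta> ^ d = \<zeta> ^ (d mod k)"
      proof -
      have "\<zeta> ^ d = \<zeta> ^ (k * (d div k) + d mod k)" by simp
      then show ?thesis by (simp only: power_add power_mult \<zeta>k power_one mult_1_left)
    qed
    ultimately have "cis (2 * pi * real (d mod k) / real k) = cis (2 * pi * real 0 / real k)"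
      using \<zeta>_pow[of "d mod k"] by simp
    moreover have "inj_on (\<lambda>j. cis (2 * pi * real j / real k)) {..<k}"
      using bij_betw_roots_unity[of k] assms(2) by (auto simp: bij_betw_def)
    ultimately have "d mod k = 0"
      using assms(2) inj_onD[of "\<lambda>j. cis (2 * pi * real j / real k)" "{..<k}" "d mod k" 0] by auto
    with that show False by auto
  qed
  define x :: "nat \<Rightarrow> complex" where "x = (\<lambda>j. if j < k then \<zeta> ^ j else 0)"
  define \<sigma> where "\<sigma> = (\<lambda>j. if j < k then Suc j mod k else j)"
  have "bij_betw \<sigma> {..<k} {..<k}"
  proof -
    have "\<sigma> ` {..<k} = {..<k}"
    proof
      show "{..<k} \<subseteq> \<sigma> ` {..<k}"
      proof
        fix j assume "j \<in> {..<k}"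
        then have "j = \<sigma> (if j = 0 then k - 1 else j - 1)" and "(if j = 0 then k - 1 else j - 1) < k"
          using assms(2) by (auto simp: \<sigma>_def)
        then show "j \<in> \<sigma> ` {..<k}" by blast
      qed
    qed (auto simp: \<sigma>_def)
    then show ?thesis
      by (simp add: bij_betw_def eq_card_imp_inj_on)
  qed
  then have "\<sigma> permutes {..<k}"
    by (intro bij_imp_permutes) (auto simp: \<sigma>_def)
  then have \<sigma>: "\<sigma> permutes {..<?n}"
    by (rule permutes_subset) (use assms(3) in auto)
  have "x (\<sigma> j) = \<zeta> * x j" for j
  proof (cases "j < k")
    case True
    then have "\<zeta> ^ (Suc j mod k) = \<zeta> ^ Suc j"
      using \<zeta>k by (cases "Suc j = k") auto
    then show ?thesis using True by (simp add: x_def \<sigma>_def)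
  qed (simp add: x_def \<sigma>_def)
  then have x\<sigma>: "x \<circ> \<sigma> = (\<lambda>j. \<zeta> * x j)"
    by auto
  have "mpoly_eval f x = 0" if f: "f \<in> set fs" for f
  proof -
    obtain j where j: "j < ?n" "f = fs ! j"
      using f fs(1) by (metis in_set_conv_nth)
    have "mpoly_eval f (x \<circ> \<sigma>) = mpoly_eval f x"
      using fs(3)[OF j(1)] \<sigma> j by (simp add: symmetric_form_def symmetric_poly_def)
    moreover have "mpoly_eval f (x \<circ> \<sigma>) = \<zeta> ^ (ds ! j) * mpoly_eval f x"
      unfolding x\<sigma> using fs(3)[OF j(1)] j by (intro mpoly_eval_scale) (simp add: symmetric_form_def)
    moreover have "\<zeta> ^ (ds ! j) \<noteq> 1"
      using no j(1) by (intro \<zeta>d) auto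
    ultimately show ?thesis by (metis mult_cancel_right1)
  qed
  then have "x 0 = 0"
    using fs(2) assms(2,3) unfolding only_common_zero_origin_def by fastforce
  then show False
    using assms(2) by (simp add: x_def)
qed

section \<open>Binary forms and rational curves\<close>

text \<open>If neither dehomogenisation has a root, both are constant by the fundamental theorem of
  algebra, and homogeneity of positive degree makes these constants vanish.\<close>

lemma binary_form_zero:
  fixes F :: "complex \<Rightarrow> complex \<Rightarrow> complex"
  assumes P: "\<And>s. F s 1 = poly P s" and Q: "\<And>t. F 1 t = poly Q t"
    and hom: "\<And>r s t. F (r * s) (r * t) = r ^ d * F s t" and d: "d > 0"
  shows "\<exists>s t. (s \<noteq> 0 \<or> t \<noteq> 0) \<and> F s t = 0"
proof (cases "constant (poly P) \<and> constant (poly Q)")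
  case True
  \<comment> \<open>The points (1/2, 1) and (1, 2) are proportional with factor 2, and each lies on
    one of the two affine charts where \<open>F\<close> is constant.\<close>
  have "F (1/2) 1 = F 1 1" "F 1 2 = F 1 1"
    using True by (auto simp: P constant_def) (auto simp: P[symmetric] Q constant_def)
  moreover have "F 1 2 = 2 ^ d * F (1/2) 1"
    using hom[of 2 "1/2" 1] by simp
  moreover have "(2::complex) ^ d \<noteq> 1"
  proof
    assume "(2::complex) ^ d = 1"
    then have "(2::real) ^ d = 1"
      using norm_power[of "2::complex" d] by simp
    then show False
      using d one_less_power[of "2::real" d] by simp
  qed
  ultimately have "F 1 1 = 0" by simp
  then show ?thesis using one_neq_zero by blast
next
  case False
  then show ?thesis
    using fundamental_theorem_of_algebra[of P] fundamental_theorem_of_algebra[of Q]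
    unfolding P[symmetric] Q[symmetric] using one_neq_zero by blast
qed

text \<open>All forms but the \<open>k\<close>-th vanish on the curve \<open>X\<close>. The
  \<open>k\<close>-th one pulls back to a binary form of positive degree \<open>e * ds ! k\<close>,
  whose nontrivial zero is, by \<open>nz\<close>, a common zero away from the origin.\<close>

lemma not_regular_degree_sequence_curve:
  fixes X :: "nat \<Rightarrow> complex \<Rightarrow> complex \<Rightarrow> complex"
  assumes P: "\<And>i s. X i s 1 = poly (P i) s" and Q: "\<And>i t. X i 1 t = poly (Q i) t"
    and hom: "\<And>i r s t. X i (r * s) (r * t) = r ^ e * X i s t" and e: "e > 0"
    and nz: "\<And>s t. (\<And>i. i < length ds \<Longrightarrow> X i s t = 0) \<Longrightarrow> s = 0 \<and> t = 0"
    and k: "k < length ds" "ds ! k > 0"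
    and vanish: "\<And>j f s t. j < length ds \<Longrightarrow> j \<noteq> k \<Longrightarrow> symmetric_form (length ds) (ds ! j) f \<Longrightarrow>
        mpoly_eval f (\<lambda>i. X i s t) = 0"
  shows "\<not> regular_degree_sequence ds"
proof
  let ?n = "length ds"
  assume "regular_degree_sequence ds"
  then obtain fs where fs: "length fs = ?n" "only_common_zero_origin ?n fs"
    "\<And>j. j < ?n \<Longrightarrow> symmetric_form ?n (ds ! j) (fs ! j)"
    unfolding regular_degree_sequence_def Let_def symmetric_form_def
      homogeneous_of_deg_def by blast
  define F where "F = (\<lambda>s t. mpoly_eval (fs ! k) (\<lambda>i. X i s t))"
  obtain P' where "\<And>s. F s 1 = poly P' s"
    using mpoly_eval_poly[of "fs ! k" P] by (auto simp: F_def P)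
  moreover obtain Q' where "\<And>t. F 1 t = poly Q' t"
    using mpoly_eval_poly[of "fs ! k" Q] by (auto simp: F_def Q)
  moreover have "F (r * s) (r * t) = r ^ (e * ds ! k) * F s t" for r s t
    unfolding F_def hom power_mult using fs(3)[OF k(1)]
    by (intro mpoly_eval_scale) (simp add: symmetric_form_def)
  ultimately obtain s t where st: "s \<noteq> 0 \<or> t \<noteq> 0" "F s t = 0"
    using binary_form_zero[of F P' Q' "e * ds ! k"] e k(2) by auto
  have "\<forall>f\<in>set fs. mpoly_eval f (\<lambda>i. X i s t) = 0"
  proof
    fix f assume "f \<in> set fs"
    then obtain j where "j < ?n" "f = fs ! j"
      using fs(1) by (metis in_set_conv_nth)
    then show "mpoly_eval f (\<lambda>i. X i s t) = 0"
      using vanish[of j f s t] fs(3)[of j] st(2) by (cases "j = k") (auto simp: F_def)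
  qed
  then have "\<forall>i<?n. X i s t = 0"
    using fs(2) unfolding only_common_zero_origin_def by (auto dest: spec[of _ "\<lambda>i. X i s t"])
  then show False using nz st(1) by blast
qed

section \<open>Two linear forms in three variables\<close>

lemma symmetric_form_3_linear:
  assumes "symmetric_form 3 1 f" "x 0 + x 1 + x 2 = 0"
  shows "mpoly_eval f x = 0"
proof (rule symmetric_form_sum_permutes[OF assms(1)])
  fix a :: "nat \<Rightarrow> nat"
  assume "(\<Sum>i<3. a i) = 1"
  then have a: "a 0 + a 1 + a 2 = 1"
    by (simp add: eval_nat_numeral)
  have *: "{..<3::nat} = insert 0 (insert 1 (insert 2 {}))" by auto
  have "(\<Sum>\<sigma>\<in>{\<sigma>. \<sigma> permutes {..<3}}. \<Prod>i<3. x (\<sigma> i) ^ a i) =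
     x 0 ^ a 0 * x 1 ^ a 1 * x 2 ^ a 2 + x 0 ^ a 0 * x 2 ^ a 1 * x 1 ^ a 2 +
     x 1 ^ a 0 * x 0 ^ a 1 * x 2 ^ a 2 + x 1 ^ a 0 * x 2 ^ a 1 * x 0 ^ a 2 +
     x 2 ^ a 0 * x 0 ^ a 1 * x 1 ^ a 2 + x 2 ^ a 0 * x 1 ^ a 1 * x 0 ^ a 2"
    unfolding * by (simp add: sum_over_permutations_insert transpose_def permutes_sing algebra_simps)
  \<comment> \<open>The monomial is a single variable, and each coordinate is its image under two of
    the six permutations.\<close>
  also have "\<dots> = 2 * (x 0 + x 1 + x 2)"
  proof -
    consider "a 0 = 1" "a 1 = 0" "a 2 = 0" | "a 0 = 0" "a 1 = 1" "a 2 = 0" | "a 0 = 0" "a 1 = 0" "a 2 = 1"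
      using a by linarith
    then show ?thesis by cases (simp_all add: algebra_simps)
  qed
  finally show "(\<Sum>\<sigma>\<in>{\<sigma>. \<sigma> permutes {..<3}}. \<Prod>i<3. x (\<sigma> i) ^ a i) = 0"
    using assms(2) by (simp only: mult_zero_right)
qed

lemma not_regular_degree_sequence_1_1:
  assumes "d > 0"
  shows "\<not> regular_degree_sequence [1, 1, d]"
proof (rule not_regular_degree_sequence_curve)
  let ?X = "\<lambda>i s t :: complex. if i = 0 then s else if i = 1 then t else - s - t"
  show "?X i s 1 = poly (if i = 0 then [:0, 1:] else if i = 1 then 1 else [:-1, -1:]) s" for i :: nat and s
    by simp
  show "?X i 1 t = poly (if i = 0 then 1 else if i = 1 then [:0, 1:] else [:-1, -1:]) t" for i :: nat and t
    by simp
  show "?X i (r * s) (r * t) = r ^ 1 * ?X i s t" for i :: nat and r s t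
    by (simp add: algebra_simps)
  show "s = 0 \<and> t = 0" if "\<And>i. i < length [1, 1, d] \<Longrightarrow> ?X i s t = 0" for s t
    using that[of 0] that[of 1] by simp
  show "mpoly_eval f (\<lambda>i. ?X i s t) = 0"
    if "j < length [1, 1, d]" "j \<noteq> 2" "symmetric_form (length [1, 1, d]) ([1, 1, d] ! j) f" for j f s t
  proof (rule symmetric_form_3_linear)
    have "j = 0 \<or> j = 1" using that by auto
    with that(3) show "symmetric_form 3 1 f" by (auto simp: numeral_3_eq_3)
  qed simp
qed (use assms in auto)

section \<open>Degrees 1, 2 and 5 on a conic in four variables\<close>

lemma power_sum_5_eq_0:
  fixes w x y z :: complex
  assumes "w + x + y + z = 0" "w^2 + x^2 + y^2 + z^2 = 0"
  shows "w^5 + x^5 + y^5 + z^5 = 0"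
proof -
  have z: "z = - (w + x + y)"
    using assms(1) by algebra
  \<comment> \<open>Newton's identities with e_1 = e_5 = 0 give 2 p_5 = 5 p_2 e_3, and eliminating
    \<open>z\<close> turns e_3 into \<open>- (w + x) * (w + y) * (x + y)\<close>.\<close>
  have "2 * (w^5 + x^5 + y^5 + z^5) = - 5 * (w + x) * (w + y) * (x + y) * (w^2 + x^2 + y^2 + z^2)"
    unfolding z by algebra
  then have "2 * (w^5 + x^5 + y^5 + z^5) = 0"
    by (simp only: assms(2) mult_zero_right)
  then show ?thesis by (simp only: mult_eq_0_iff) simp
qed

lemma symmetric_form_4_vanish:
  fixes x :: "nat \<Rightarrow> complex"
  assumes f: "symmetric_form 4 d f" and d: "d \<in> {1, 2, 5}"
    and x: "x 0 + x 1 + x 2 + x 3 = 0" "x 0 ^ 2 + x 1 ^ 2 + x 2 ^ 2 + x 3 ^ 2 = 0"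
  shows "mpoly_eval f x = 0"
proof (rule symmetric_form_sum_permutes[OF f])
  fix a :: "nat \<Rightarrow> nat"
  assume "(\<Sum>i<4. a i) = d"
  then have a: "a 0 + a 1 + a 2 + a 3 \<in> {1, 2, 5}"
    using d by (simp add: eval_nat_numeral)
  define p where "p = (\<lambda>k. x 0 ^ k + x 1 ^ k + x 2 ^ k + x 3 ^ k)"
  have p: "p k = 0" if "k \<in> {1, 2, 5}" for k
    using that x power_sum_5_eq_0[OF x] by (auto simp: p_def)
  text \<open>The sum over injections expands into products of power sums; each of these contains a
    factor of degree 1, 2 or 5, as numbers from \<^term>\<open>{0, 3, 4 :: nat}\<close> never sum to 1, 2 or 5.\<close>
  have p2: "p i * p j = 0" if "i + j \<in> {1, 2, 5}" for i j
  proof -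
    have "i \<in> {1, 2, 5} \<or> j \<in> {1, 2, 5}"
      using that by simp presburger
    then show ?thesis using p by auto
  qed
  \<comment> \<open>\<open>m2\<close>, \<open>m3\<close> and \<open>m4\<close> range over ordered
    pairs, triples and quadruples of distinct coordinates.\<close>
  define m2 where "m2 = (\<lambda>i j. x 0 ^ i * x 1 ^ j + x 0 ^ i * x 2 ^ j + x 0 ^ i * x 3 ^ j +
        x 1 ^ i * x 0 ^ j + x 1 ^ i * x 2 ^ j + x 1 ^ i * x 3 ^ j +
        x 2 ^ i * x 0 ^ j + x 2 ^ i * x 1 ^ j + x 2 ^ i * x 3 ^ j +
        x 3 ^ i * x 0 ^ j + x 3 ^ i * x 1 ^ j + x 3 ^ i * x 2 ^ j)"
  define m3 where "m3 = (\<lambda>i j k. x 0 ^ i * x 1 ^ j * x 2 ^ k + x 0 ^ i * x 1 ^ j * x 3 ^ k + x 0 ^ i * x 2 ^ j * x 1 ^ k +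
        x 0 ^ i * x 2 ^ j * x 3 ^ k + x 0 ^ i * x 3 ^ j * x 1 ^ k + x 0 ^ i * x 3 ^ j * x 2 ^ k +
        x 1 ^ i * x 0 ^ j * x 2 ^ k + x 1 ^ i * x 0 ^ j * x 3 ^ k + x 1 ^ i * x 2 ^ j * x 0 ^ k +
        x 1 ^ i * x 2 ^ j * x 3 ^ k + x 1 ^ i * x 3 ^ j * x 0 ^ k + x 1 ^ i * x 3 ^ j * x 2 ^ k +
        x 2 ^ i * x 0 ^ j * x 1 ^ k + x 2 ^ i * x 0 ^ j * x 3 ^ k + x 2 ^ i * x 1 ^ j * x 0 ^ k +
        x 2 ^ i * x 1 ^ j * x 3 ^ k + x 2 ^ i * x 3 ^ j * x 0 ^ k + x 2 ^ i * x 3 ^ j * x 1 ^ k +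
        x 3 ^ i * x 0 ^ j * x 1 ^ k + x 3 ^ i * x 0 ^ j * x 2 ^ k + x 3 ^ i * x 1 ^ j * x 0 ^ k +
        x 3 ^ i * x 1 ^ j * x 2 ^ k + x 3 ^ i * x 2 ^ j * x 0 ^ k + x 3 ^ i * x 2 ^ j * x 1 ^ k)"
  define m4 where "m4 = (\<lambda>i j k l. x 0 ^ i * x 1 ^ j * x 2 ^ k * x 3 ^ l + x 0 ^ i * x 1 ^ j * x 3 ^ k * x 2 ^ l + x 0 ^ i * x 2 ^ j * x 1 ^ k * x 3 ^ l +
        x 0 ^ i * x 2 ^ j * x 3 ^ k * x 1 ^ l + x 0 ^ i * x 3 ^ j * x 1 ^ k * x 2 ^ l + x 0 ^ i * x 3 ^ j * x 2 ^ k * x 1 ^ l +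
        x 1 ^ i * x 0 ^ j * x 2 ^ k * x 3 ^ l + x 1 ^ i * x 0 ^ j * x 3 ^ k * x 2 ^ l + x 1 ^ i * x 2 ^ j * x 0 ^ k * x 3 ^ l +
        x 1 ^ i * x 2 ^ j * x 3 ^ k * x 0 ^ l + x 1 ^ i * x 3 ^ j * x 0 ^ k * x 2 ^ l + x 1 ^ i * x 3 ^ j * x 2 ^ k * x 0 ^ l +
        x 2 ^ i * x 0 ^ j * x 1 ^ k * x 3 ^ l + x 2 ^ i * x 0 ^ j * x 3 ^ k * x 1 ^ l + x 2 ^ i * x 1 ^ j * x 0 ^ k * x 3 ^ l +
        x 2 ^ i * x 1 ^ j * x 3 ^ k * x 0 ^ l + x 2 ^ i * x 3 ^ j * x 0 ^ k * x 1 ^ l + x 2 ^ i * x 3 ^ j * x 1 ^ k * x 0 ^ l +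
        x 3 ^ i * x 0 ^ j * x 1 ^ k * x 2 ^ l + x 3 ^ i * x 0 ^ j * x 2 ^ k * x 1 ^ l + x 3 ^ i * x 1 ^ j * x 0 ^ k * x 2 ^ l +
        x 3 ^ i * x 1 ^ j * x 2 ^ k * x 0 ^ l + x 3 ^ i * x 2 ^ j * x 0 ^ k * x 1 ^ l + x 3 ^ i * x 2 ^ j * x 1 ^ k * x 0 ^ l)"
  have m2: "m2 i j = 0" if "i + j \<in> {1, 2, 5}" for i j
  proof -
    have "m2 i j = p i * p j - p (i + j)"
      by (simp add: m2_def p_def power_add algebra_simps)
    then show ?thesis using p2[OF that] p[OF that] by simp
  qed
  have m2p: "m2 i j * p k = 0" if "i + j + k \<in> {1, 2, 5}" for i j k
  proof -
    have "i + j \<in> {1, 2, 5} \<or> k \<in> {1, 2, 5}"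
      using that by simp presburger
    then show ?thesis using p m2 by auto
  qed
  have m3: "m3 i j k = 0" if "i + j + k \<in> {1, 2, 5}" for i j k
  proof -
    \<comment> \<open>In the product with \<open>p k\<close> the new coordinate may coincide with an
      earlier one; each coincidence merges two exponents and is subtracted. The recursion for
      \<open>m4\<close> works the same way and preserves the total degree.\<close>
    have "m3 i j k = m2 i j * p k - m2 (i + k) j - m2 i (j + k)"
      by (simp add: m3_def m2_def p_def power_add algebra_simps)
    then show ?thesis using m2p[of i j k] m2[of "i + k" j] m2[of i "j + k"] that
      by (simp add: add_ac)
  qed
  have m3p: "m3 i j k * p l = 0" if "i + j + k + l \<in> {1, 2, 5}" for i j k l
  proof -
    have "i + j + k \<in> {1, 2, 5} \<or> l \<in> {1, 2, 5}"
      using that by simp presburger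
    then show ?thesis using p m3 by auto
  qed
  have m4: "m4 i j k l = 0" if "i + j + k + l \<in> {1, 2, 5}" for i j k l
  proof -
    have "m4 i j k l = m3 i j k * p l - m3 (i + l) j k - m3 i (j + l) k - m3 i j (k + l)"
      by (simp add: m4_def m3_def p_def power_add algebra_simps)
    then show ?thesis
      using m3p[of i j k l] m3[of "i + l" j k] m3[of i "j + l" k] m3[of i j "k + l"] that
      by (simp add: add_ac)
  qed
  have *: "{..<4::nat} = insert 0 (insert 1 (insert 2 (insert 3 {})))" by auto
  have "(\<Sum>\<sigma>\<in>{\<sigma>. \<sigma> permutes {..<4}}. \<Prod>i<4. x (\<sigma> i) ^ a i) = m4 (a 0) (a 1) (a 2) (a 3)"
    unfolding * m4_def
    by (simp add: sum_over_permutations_insert transpose_def algebra_simps)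
  with m4 a show "(\<Sum>\<sigma>\<in>{\<sigma>. \<sigma> permutes {..<4}}. \<Prod>i<4. x (\<sigma> i) ^ a i) = 0"
    by simp
qed

lemma not_regular_degree_sequence_1_2_5:
  assumes "{a, b, c} \<subseteq> {1, 2, 5}" "d > 0"
  shows "\<not> regular_degree_sequence [a, b, c, d]"
proof -
  text \<open>A parametrisation of the conic where the first two power sums vanish:
    \<^term>\<open>X k = A * \<i> ^ k + B * (- 1) ^ k + C * (- \<i>) ^ k\<close> with
    \<^term>\<open>B ^ 2 = - 2 * A * C\<close>.\<close>
  let ?X = "\<lambda>k s t. s^2 * \<i> ^ k + 2 * s * t * (-1) ^ k - 2 * t^2 * (-\<i>) ^ k"
  show ?thesis
  proof (rule not_regular_degree_sequence_curve[where X = ?X])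
    show "?X k s 1 = poly [:- 2 * (-\<i>) ^ k, 2 * (-1) ^ k, \<i> ^ k:] s" for k s
      by (simp add: power2_eq_square algebra_simps)
    show "?X k 1 t = poly [:\<i> ^ k, 2 * (-1) ^ k, - 2 * (-\<i>) ^ k:] t" for k t
      by (simp add: power2_eq_square algebra_simps)
    show "?X k (r * s) (r * t) = r ^ 2 * ?X k s t" for k r s t
      by (simp add: power2_eq_square algebra_simps)
    show "s = 0 \<and> t = 0" if "\<And>k. k < length [a, b, c, d] \<Longrightarrow> ?X k s t = 0" for s t
    proof -
      have "?X 0 s t = 0" "?X 2 s t = 0"
        \<comment> \<open>Coordinates 0 and 2 suffice: their sum is 4st, and once one of
          \<open>s\<close>, \<open>t\<close> is 0, so is the other.\<close>
        by (rule that, simp)+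
      then have *: "s^2 + 2 * s * t - 2 * t^2 = 0" "- (s^2) + 2 * s * t + 2 * t^2 = 0"
        by simp_all
      have "4 * (s * t) = 0" using * by algebra
      then have "s = 0 \<or> t = 0" by simp
      then show ?thesis using * by auto
    qed
    show "mpoly_eval f (\<lambda>k. ?X k s t) = 0"
      if "j < length [a, b, c, d]" "j \<noteq> 3"
        "symmetric_form (length [a, b, c, d]) ([a, b, c, d] ! j) f" for j f s t
    proof (rule symmetric_form_4_vanish)
      have "j = 0 \<or> j = 1 \<or> j = 2" using that by auto
      then show "[a, b, c, d] ! j \<in> {1, 2, 5}" using assms(1) by auto
      show "symmetric_form 4 ([a, b, c, d] ! j) f" using that(3) by (simp add: numeral_eq_Suc)
      have i: "\<i> ^ 3 = - \<i>" by (simp add: power3_eq_cube)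
      \<comment> \<open>The sequence \<open>X k\<close> has no constant Fourier mode, so its sum
        over a period is 0. The sum of squares below is \<open>4 * (B ^ 2 + 2 * A * C)\<close>,
        which is 0 by the choice of \<open>B\<close>.\<close>
      show "?X 0 s t + ?X 1 s t + ?X 2 s t + ?X 3 s t = 0"
        by (simp add: i algebra_simps)
      show "(?X 0 s t)^2 + (?X 1 s t)^2 + (?X 2 s t)^2 + (?X 3 s t)^2 = 0"
        by (simp add: i power2_eq_square algebra_simps)
    qed
  qed (use assms in auto)
qed

section \<open>Constructions\<close>

lemma symmetric_form_power_sum_power:
  "d = k * a \<Longrightarrow> symmetric_form n d (power_sum n k ^ a)"
  by (simp add: symmetric_form_power symmetric_form_power_sum)

lemma symmetric_form_power_sum_mult:
  "d = k * a + l * b \<Longrightarrow> symmetric_form n d (power_sum n k ^ a * power_sum n l ^ b)"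
  by (simp add: symmetric_form_mult symmetric_form_power_sum_power)

lemma power_sum_unit_vector:
  assumes "n > 0" "k > 0"
  shows "mpoly_eval (power_sum n k) (\<lambda>i. if i = 0 then 1 else 0) = 1"
proof -
  have "(\<Sum>i<n. (if i = 0 then 1 else 0 :: complex) ^ k) = (\<Sum>i<n. if i = 0 then 1 else 0)"
    using assms(2) by (intro sum.cong) auto
  then show ?thesis
    using assms(1) by (simp add: mpoly_eval_power_sum)
qed

text \<open>Distinct degrees serve distinct power sums; the zero-based position \<open>j\<close>
  carries a power of the power sum of weight \<open>Suc j\<close>.\<close>

lemma regular_degree_sequence_dvd_all:
  assumes "\<And>j. j < length ds \<Longrightarrow> Suc j dvd ds ! j \<and> ds ! j > 0"
  shows "regular_degree_sequence ds"
proof (rule regular_degree_sequenceI[OF _ refl])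
  let ?n = "length ds"
  let ?fs = "map (\<lambda>j. power_sum ?n (Suc j) ^ (ds ! j div Suc j)) [0..<?n]"
  show "list_all2 (symmetric_form ?n) ds ?fs"
    using assms by (auto simp: list_all2_conv_all_nth intro!: symmetric_form_power_sum_power
        simp del: mult_Suc)
  show "\<forall>f\<in>set ?fs. mpoly_eval f (\<lambda>i. if i = 0 then 1 else 0) \<noteq> 0"
    by (cases "ds = []") (auto simp: mpoly_eval_power power_sum_unit_vector)
  show "mpoly_eval (power_sum ?n k) x = 0"
    if "\<forall>f\<in>set ?fs. mpoly_eval f x = 0" "1 \<le> k" "k \<le> ?n" for x k
  proof -
    have "mpoly_eval (power_sum ?n (Suc (k - 1)) ^ (ds ! (k - 1) div Suc (k - 1))) x = 0"
      using that(2,3) by (intro bspec[OF that(1)]) (auto intro!: image_eqI[of _ _ "k - 1"])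
    then show ?thesis
      using that(2) by (simp add: mpoly_eval_power)
  qed
qed

section \<open>Degrees that serve two power sums at once\<close>

lemma semigroup_2_3: "2 \<le> (b::nat) \<Longrightarrow> \<exists>u v. b = 2 * u + 3 * v"
  by presburger

text \<open>1, 2 and 5 are the gaps of the numerical semigroup generated by 3 and 4; this is where
  the exceptional degrees come from.\<close>

lemma semigroup_3_4: "(b::nat) \<notin> {1, 2, 5} \<Longrightarrow> \<exists>u v. b = 3 * u + 4 * v"
  by simp presburger

text \<open>The monomial in degree \<open>b\<close> makes p_2 or p_3 vanish, and the sum in degree
  \<open>a\<close> then makes the other one vanish.\<close>

lemma regular_degree_sequence_3:
  assumes "2 \<le> b" "6 dvd a" "a > 0" "c > 0"
  shows "regular_degree_sequence [c, b, a]"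
proof -
  let ?p = "power_sum 3"
  obtain d where a: "a = 6 * d" "d > 0" using assms(2,3) by auto
  obtain u v where b: "b = 2 * u + 3 * v"
    using semigroup_2_3[OF assms(1)] by blast
  let ?fs = "[?p 1 ^ c, ?p 2 ^ u * ?p 3 ^ v, ?p 2 ^ (3 * d) + ?p 3 ^ (2 * d)]"
  show ?thesis
  proof (rule regular_degree_sequenceI[where fs = ?fs and n = 3])
    show "list_all2 (symmetric_form 3) [c, b, a] ?fs"
      by (auto intro!: symmetric_form_add symmetric_form_power_sum_power symmetric_form_power_sum_mult
          simp: a b)
    show "\<forall>f\<in>set ?fs. mpoly_eval f (\<lambda>i. if i = 0 then 1 else 0) \<noteq> 0"
      by (auto simp: mpoly_eval_power mpoly_eval_mult mpoly_eval_add power_sum_unit_vector)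
    show "mpoly_eval (?p k) x = 0"
      if "\<forall>f\<in>set ?fs. mpoly_eval f x = 0" "1 \<le> k" "k \<le> 3" for x k
    proof -
      have "k = 1 \<or> k = 2 \<or> k = 3" using that(2,3) by linarith
      moreover have "mpoly_eval (?p 1) x = 0 \<and> mpoly_eval (?p 2) x = 0 \<and> mpoly_eval (?p 3) x = 0"
        using that(1) a assms(4)
        by (auto simp: mpoly_eval_power mpoly_eval_mult mpoly_eval_add power_0_left)
      ultimately show ?thesis by auto
    qed
  qed simp
qed

text \<open>The pair p_2, p_3 is handled by the degrees \<open>b\<close> and \<open>a'\<close>,
  leaving \<open>a\<close> for p_4 and \<open>c\<close> for p_1.\<close>

lemma regular_degree_sequence_4_odd:
  assumes "odd b" "5 \<le> b" "4 dvd a" "a > 0" "6 dvd a'" "a' > 0" "c > 0"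
  shows "regular_degree_sequence [c, b, a, a']"
proof -
  let ?p = "power_sum 4"
  obtain d where a: "a = 4 * d" "d > 0" using assms(3,4) by auto
  obtain d' where a': "a' = 6 * d'" "d' > 0" using assms(5,6) by auto
  obtain u where b: "b = 2 * u + 3 * 1" "u > 0"
    using assms(1,2) by (intro that[of "(b - 3) div 2"]) presburger+
  let ?fs = "[?p 1 ^ c, ?p 2 ^ u * ?p 3 ^ 1, ?p 4 ^ d, ?p 2 ^ (3 * d') + ?p 3 ^ (2 * d')]"
  show ?thesis
  proof (rule regular_degree_sequenceI[where fs = ?fs and n = 4])
    show "list_all2 (symmetric_form 4) [c, b, a, a'] ?fs"
      unfolding a a' b list_all2_Cons
      by (intro conjI symmetric_form_add symmetric_form_power_sum_power symmetric_form_power_sum_mult) simp_all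
    show "\<forall>f\<in>set ?fs. mpoly_eval f (\<lambda>i. if i = 0 then 1 else 0) \<noteq> 0"
      by (auto simp: mpoly_eval_power mpoly_eval_mult mpoly_eval_add power_sum_unit_vector)
    show "mpoly_eval (?p k) x = 0"
      if "\<forall>f\<in>set ?fs. mpoly_eval f x = 0" "1 \<le> k" "k \<le> 4" for x k
    proof -
      have "k = 1 \<or> k = 2 \<or> k = 3 \<or> k = 4" using that(2,3) by linarith
      moreover have "mpoly_eval (?p 1) x = 0 \<and> mpoly_eval (?p 2) x = 0 \<and>
          mpoly_eval (?p 3) x = 0 \<and> mpoly_eval (?p 4) x = 0"
        using that(1) a a' b assms(7)
        by (auto simp: mpoly_eval_power mpoly_eval_mult mpoly_eval_add power_0_left)
      ultimately show ?thesis by auto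
    qed
  qed simp
qed

text \<open>The pair p_3, p_4 is handled by the degrees \<open>b\<close> and \<open>a\<close>, which
  works because \<open>b\<close> is not a gap of the semigroup of 3 and 4.\<close>

lemma regular_degree_sequence_4_semigroup:
  assumes "b \<notin> {1, 2, 5}" "12 dvd a" "a > 0" "even e" "e > 0" "c > 0"
  shows "regular_degree_sequence [c, b, e, a]"
proof -
  let ?p = "power_sum 4"
  obtain d where a: "a = 12 * d" "d > 0" using assms(2,3) by auto
  obtain m where e: "e = 2 * m" "m > 0" using assms(4,5) by auto
  obtain u v where b: "b = 3 * u + 4 * v"
    using semigroup_3_4[OF assms(1)] by blast
  let ?fs = "[?p 1 ^ c, ?p 3 ^ u * ?p 4 ^ v, ?p 2 ^ m, ?p 3 ^ (4 * d) + ?p 4 ^ (3 * d)]"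
  show ?thesis
  proof (rule regular_degree_sequenceI[where fs = ?fs and n = 4])
    show "list_all2 (symmetric_form 4) [c, b, e, a] ?fs"
      unfolding a e b list_all2_Cons
      by (intro conjI symmetric_form_add symmetric_form_power_sum_power symmetric_form_power_sum_mult) simp_all
    show "\<forall>f\<in>set ?fs. mpoly_eval f (\<lambda>i. if i = 0 then 1 else 0) \<noteq> 0"
      by (auto simp: mpoly_eval_power mpoly_eval_mult mpoly_eval_add power_sum_unit_vector)
    show "mpoly_eval (?p k) x = 0"
      if "\<forall>f\<in>set ?fs. mpoly_eval f x = 0" "1 \<le> k" "k \<le> 4" for x k
    proof -
      have "k = 1 \<or> k = 2 \<or> k = 3 \<or> k = 4" using that(2,3) by linarith
      moreover have "mpoly_eval (?p 1) x = 0 \<and> mpoly_eval (?p 2) x = 0 \<and>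
          mpoly_eval (?p 3) x = 0 \<and> mpoly_eval (?p 4) x = 0"
        using that(1) a e assms(6)
        by (auto simp: mpoly_eval_power mpoly_eval_mult mpoly_eval_add power_0_left)
      ultimately show ?thesis by auto
    qed
  qed simp
qed

text \<open>Degree 5 only offers p_2 p_3 here. If p_3 = 0, the form in degree \<open>e\<close> gives
  p_2 = 0 because \<open>u > 0\<close>, and the last form gives p_4 = 0. If p_2 = 0, the form in
  degree \<open>e\<close> leaves p_3 or p_4 zero, and the last form kills the other.\<close>

lemma regular_degree_sequence_4_5:
  assumes "12 dvd a" "a > 0" "even e" "\<not> 4 dvd e" "e > 2" "c > 0"
  shows "regular_degree_sequence [c, 5, e, a]"
proof -
  let ?p = "power_sum 4"
  obtain d where a: "a = 12 * d" "d > 0" using assms(1,2) by auto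
  obtain m where m: "e = 2 * m" "m > 0" using assms(3,5) by auto
  have e_ne: "e \<notin> {1, 2, 5}" using assms(3,5) by auto
  obtain u v where e: "e = 3 * u + 4 * v"
    using semigroup_3_4[of e] e_ne by blast
  \<comment> \<open>Otherwise \<open>e = 4 * v\<close>, against the assumption on
    \<open>e\<close>.\<close>
  have u: "u > 0" using e assms(4) by (cases u) auto
  let ?fs = "[?p 1 ^ c, ?p 2 ^ 1 * ?p 3 ^ 1, ?p 3 ^ u * ?p 4 ^ v + ?p 2 ^ m,
    ?p 3 ^ (4 * d) + ?p 4 ^ (3 * d)]"
  have "symmetric_form 4 e (?p 3 ^ u * ?p 4 ^ v + ?p 2 ^ m)"
    using e m by (intro symmetric_form_add symmetric_form_power_sum_power symmetric_form_power_sum_mult) auto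
  moreover have "symmetric_form 4 a (?p 3 ^ (4 * d) + ?p 4 ^ (3 * d))"
    using a by (intro symmetric_form_add symmetric_form_power_sum_power) auto
  moreover have "symmetric_form 4 5 (?p 2 ^ 1 * ?p 3 ^ 1)"
    by (intro symmetric_form_power_sum_mult) simp
  moreover have "symmetric_form 4 c (?p 1 ^ c)"
    by (intro symmetric_form_power_sum_power) simp
  ultimately have list: "list_all2 (symmetric_form 4) [c, 5, e, a] ?fs"
    by simp
  show ?thesis
  proof (rule regular_degree_sequenceI[where fs = ?fs and n = 4])
    show "list_all2 (symmetric_form 4) [c, 5, e, a] ?fs" by (fact list)
    show "\<forall>f\<in>set ?fs. mpoly_eval f (\<lambda>i. if i = 0 then 1 else 0) \<noteq> 0"
      by (auto simp: mpoly_eval_power mpoly_eval_mult mpoly_eval_add power_sum_unit_vector)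
    show "mpoly_eval (?p k) x = 0"
      if "\<forall>f\<in>set ?fs. mpoly_eval f x = 0" "1 \<le> k" "k \<le> 4" for x k
    proof -
      have "k = 1 \<or> k = 2 \<or> k = 3 \<or> k = 4" using that(2,3) by linarith
      moreover have "mpoly_eval (?p 1) x = 0 \<and> mpoly_eval (?p 2) x = 0 \<and>
          mpoly_eval (?p 3) x = 0 \<and> mpoly_eval (?p 4) x = 0"
        using that(1) a m u assms(6)
        by (auto simp: mpoly_eval_power mpoly_eval_mult mpoly_eval_add power_0_left)
      ultimately show ?thesis by auto
    qed
  qed simp
qed

section \<open>Classification\<close>

lemma card_nth_eq_size_filter_mset:
  "card {j. j < length ds \<and> P (ds ! j)} = size (filter_mset P (mset ds))"
  by (metis length_filter_conv_card mset_filter size_mset)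

lemma cond_star_mset: "cond_star ds \<longleftrightarrow>
    (\<forall>i\<in>{1..length ds}. length ds div i \<le> size (filter_mset (\<lambda>d. i dvd d) (mset ds)))"
  unfolding cond_star_def Let_def
    card_nth_eq_size_filter_mset[where P = "\<lambda>d. i dvd d" for i] ..

lemma cond_dagger_mset: "cond_dagger ds \<longleftrightarrow>
    (\<forall>i\<in>{1..length ds}. size (filter_mset (\<lambda>d. d \<le> i) (mset ds)) \<le> i)"
  unfolding cond_dagger_def Let_def
    card_nth_eq_size_filter_mset[where P = "\<lambda>d. d \<le> i" for i] ..

lemma permissible_mset:
  assumes "mset ds = mset ds'"
  shows "permissible ds \<longleftrightarrow> permissible ds'"
  using assms mset_eq_length[OF assms]
  unfolding permissible_def cond_star_mset cond_dagger_mset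
  by simp

lemma cond_star_2: "cond_star [a, b] \<longleftrightarrow> even a \<or> even b"
proof -
  have len: "length [a, b] = 2" and "{1..2::nat} = {1, 2}" by auto
  then show ?thesis
    unfolding cond_star_mset len by simp
qed

lemma permissible_2:
  assumes "a > 0" "b > 0"
  shows "permissible [a, b] \<longleftrightarrow> even a \<or> even b"
proof -
  have len: "length [a, b] = 2" and "{1..2::nat} = {1, 2}" by auto
  then have "cond_dagger [a, b] \<longleftrightarrow> \<not> (a \<le> 1 \<and> b \<le> 1)"
    unfolding cond_dagger_mset len by simp
  moreover have "\<not> (a \<le> 1 \<and> b \<le> 1)" if "even a \<or> even b"
    using that assms by presburger
  ultimately show ?thesis
    unfolding permissible_def cond_star_2 by blast
qed

text \<open>A multiple of 3 exceeds 2, so what remains of \<open>cond_dagger\<close> is that no two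
  degrees equal 1.\<close>

lemma permissible_3:
  assumes "a > 0" "b > 0" "c > 0"
  shows "permissible [a, b, c] \<longleftrightarrow> (even a \<or> even b \<or> even c) \<and> (3 dvd a \<or> 3 dvd b \<or> 3 dvd c) \<and>
    \<not> (a = 1 \<and> b = 1) \<and> \<not> (a = 1 \<and> c = 1) \<and> \<not> (b = 1 \<and> c = 1)"
proof -
  have len: "length [a, b, c] = 3" by simp
  have 3: "{1..3::nat} = {1, 2, 3}" by auto
  have "cond_star [a, b, c] \<longleftrightarrow> (even a \<or> even b \<or> even c) \<and> (3 dvd a \<or> 3 dvd b \<or> 3 dvd c)"
    unfolding cond_star_mset len 3 by simp
  moreover have "\<not> (a \<le> 2 \<and> b \<le> 2 \<and> c \<le> 2)" if "3 dvd a \<or> 3 dvd b \<or> 3 dvd c"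
    using that assms by (auto dest!: dvd_imp_le)
  moreover have "cond_dagger [a, b, c] \<longleftrightarrow> \<not> (a \<le> 1 \<and> b \<le> 1) \<and> \<not> (a \<le> 1 \<and> c \<le> 1) \<and> \<not> (b \<le> 1 \<and> c \<le> 1)
      \<and> \<not> (a \<le> 2 \<and> b \<le> 2 \<and> c \<le> 2)"
    unfolding cond_dagger_mset len 3 by auto
  ultimately show ?thesis
    using assms unfolding permissible_def by (simp add: le_Suc_eq) blast
qed

text \<open>Consequences only, as permissibility is just a hypothesis for \<open>n = 4\<close>; the
  bounds are the instances of \<open>cond_dagger\<close> called for by the case analysis.\<close>

lemma permissible_4_imp:
  assumes "permissible [a, b, c, d]"
  shows "even a \<and> even b \<or> even a \<and> even c \<or> even a \<and> even d \<or> even b \<and> even c \<or>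
      even b \<and> even d \<or> even c \<and> even d"
    "3 dvd a \<or> 3 dvd b \<or> 3 dvd c \<or> 3 dvd d" "4 dvd a \<or> 4 dvd b \<or> 4 dvd c \<or> 4 dvd d"
    "\<not> (a \<le> 1 \<and> b \<le> 1)" "\<not> (c \<le> 1 \<and> d \<le> 1)"
    "\<not> (b \<le> 2 \<and> c \<le> 2 \<and> d \<le> 2)"
proof -
  have len: "length [a, b, c, d] = 4" by simp
  have star: "4 div i \<le> size (filter_mset (\<lambda>d. i dvd d) {#a, b, c, d#})"
    and dagger: "size (filter_mset (\<lambda>d. d \<le> i) {#a, b, c, d#}) \<le> i" if "i \<in> {1..4}" for i
    using assms that unfolding permissible_def cond_star_mset cond_dagger_mset
    by (simp_all add: numeral_eq_Suc)
  show "even a \<and> even b \<or> even a \<and> even c \<or> even a \<and> even d \<or> even b \<and> even c \<or>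
      even b \<and> even d \<or> even c \<and> even d"
    using star[of 2] by (auto split: if_splits)
  show "3 dvd a \<or> 3 dvd b \<or> 3 dvd c \<or> 3 dvd d"
    using star[of 3] by (auto split: if_splits)
  show "4 dvd a \<or> 4 dvd b \<or> 4 dvd c \<or> 4 dvd d"
    using star[of 4] by (auto split: if_splits)
  show "\<not> (a \<le> 1 \<and> b \<le> 1)" "\<not> (c \<le> 1 \<and> d \<le> 1)"
    using dagger[of 1] by (auto split: if_splits)
  show "\<not> (b \<le> 2 \<and> c \<le> 2 \<and> d \<le> 2)"
    using dagger[of 2] by (auto split: if_splits)
qed

text \<open>A multiple of 4 is named \<open>a\<close> and another even degree \<open>b\<close>; the
  cases ask which degrees are multiples of 3. The first four allow distinct degrees for p_2, p_3 and
  p_4. In the fifth \<open>b\<close> must serve both p_2 and p_3, in the sixth \<open>a\<close> is a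
  multiple of 12.\<close>

lemma regular_degree_sequence_4:
  assumes perm: "permissible ds" and len: "length ds = 4" and pos: "\<forall>d\<in>set ds. d > 0"
    and exc: "\<not> exceptional4 ds"
  shows "regular_degree_sequence ds"
proof -
  obtain a r where a: "mset ds = mset (a # r)" "4 dvd a" "length r = 3"
  proof -
    obtain w x y z where ds: "ds = [w, x, y, z]"
      using len by (auto simp: eval_nat_numeral length_Suc_conv)
    then have "\<exists>a\<in>set ds. 4 dvd a"
      using permissible_4_imp(3) perm by auto
    then obtain a where "a \<in> set ds" "4 dvd a" by blast
    then show ?thesis
      using len that[of a "remove1 a ds"] by (simp add: length_remove1)
  qed
  \<comment> \<open>By \<open>cond_star\<close> at 2 at least two degrees are even, so one is left
    besides \<open>a\<close>.\<close>
  obtain b c d where r: "mset r = mset [b, c, d]" "even b"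
  proof -
    obtain x y z where r: "r = [x, y, z]"
      using a(3) by (auto simp: eval_nat_numeral length_Suc_conv)
    have "permissible [a, x, y, z]"
      using perm permissible_mset[OF a(1)] r by simp
    then consider "even x" | "even y" | "even z"
      using permissible_4_imp(1) by blast
    then show ?thesis
      by cases (use that[of x y z] that[of y x z] that[of z x y] in \<open>simp_all add: r add_mset_commute\<close>)
  qed
  have ds: "mset ds = mset [a, b, c, d]"
    using a(1) r(1) by simp
  have perm: "permissible [a, b, c, d]"
    using perm permissible_mset[OF ds] by simp
  have "set ds = {a, b, c, d}"
    using mset_eq_setD[OF ds] by simp
  with pos have pos: "a > 0" "b > 0" "c > 0" "d > 0" by auto
  have reg: "regular_degree_sequence ds"
    if "regular_degree_sequence ds'" "mset ds' = mset [a, b, c, d]" for ds'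
    using regular_degree_sequence_mset[OF that(1)] that(2) ds by simp
  have dvd: "regular_degree_sequence [p, q, r, s]"
    if "p > 0" "q > 0" "r > 0" "s > 0" "even q" "3 dvd r" "4 dvd s" for p q r s :: nat
    using that by (intro regular_degree_sequence_dvd_all) (auto simp: less_Suc_eq numeral_eq_Suc)
  note cond = permissible_4_imp[OF perm]
  consider "3 dvd c" | "3 dvd d" | "even c" "3 dvd b" | "even d" "3 dvd b" | "odd c" "odd d" "3 dvd b"
      "\<not> 3 dvd c" "\<not> 3 dvd d"
    | "3 dvd a" "\<not> 3 dvd c" "\<not> 3 dvd d" "\<not> 3 dvd b"
    using cond(2) by blast
  then show ?thesis
  proof cases
    case 1
    show ?thesis by (rule reg[OF dvd[of d b c a]]) (use pos a r 1 in auto)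
  next
    case 2
    show ?thesis by (rule reg[OF dvd[of c b d a]]) (use pos a r 2 in auto)
  next
    case 3
    show ?thesis by (rule reg[OF dvd[of d c b a]]) (use pos a r 3 in auto)
  next
    case 4
    show ?thesis by (rule reg[OF dvd[of c d b a]]) (use pos a r 4 in auto)
  next
    case 5
    \<comment> \<open>\<open>c\<close> and \<open>d\<close> are odd and not multiples of 3, hence 1
      or at least 5, and \<open>cond_dagger\<close> forbids that both are 1.\<close>
    have "6 dvd b" using r(2) 5 by presburger
    show ?thesis
    proof (cases "c = 1")
      case True
      then have "d \<ge> 5" using cond(5) 5 by presburger
      show ?thesis
        by (rule reg[OF regular_degree_sequence_4_odd[of d a b c]])
          (use pos a 5 \<open>d \<ge> 5\<close> \<open>6 dvd b\<close> in auto)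
    next
      case False
      then have "c \<ge> 5" using 5 by presburger
      show ?thesis
        by (rule reg[OF regular_degree_sequence_4_odd[of c a b d]])
          (use pos a 5 \<open>c \<ge> 5\<close> \<open>6 dvd b\<close> in auto)
    qed
  next
    case 6
    have a12: "12 dvd a" using 6 a(2) by presburger
    have semi: ?thesis if "mset [q, p, e, a] = mset [a, b, c, d]" "p \<notin> {1, 2, 5}" "even e" for q p e
    proof -
      have "{q, p, e, a} = {a, b, c, d}"
        using mset_eq_setD[OF that(1)] by simp
      then have "q > 0" "e > 0" using pos by auto
      then show ?thesis
        using that a12 pos(1) by (intro reg[OF regular_degree_sequence_4_semigroup[of p a e q]]) auto
    qed
    have exc': "mset [a, b, c, d] \<notin> {{#1, 2, 5, a#}, {#2, 2, 5, a#}, {#5, 2, 5, a#}}"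
    proof -
      obtain k where "a = 12 * k" "k > 0" using a12 pos(1) by auto
      then show ?thesis
        using exc unfolding exceptional4_def ds \<open>a = 12 * k\<close> by blast
    qed
    \<comment> \<open>In the first four cases a degree outside the gaps can be paired with
      \<open>a\<close> while another even degree is left for p_2.\<close>
    consider "c \<notin> {1, 2, 5}" | "d \<notin> {1, 2, 5}" | "c = 2" "b \<notin> {1, 2, 5}" | "d = 2" "b \<notin> {1, 2, 5}"
      | "b = 2" "c \<in> {1, 2, 5}" "d \<in> {1, 2, 5}" | "b > 2" "c \<in> {1, 5}" "d \<in> {1, 5}"
      using r(2) pos(2) by fastforce
    then show ?thesis
    proof cases
      case 1
      show ?thesis by (rule semi[of d c b]) (use 1 r in auto)
    next
      case 2
      show ?thesis by (rule semi[of c d b]) (use 2 r in auto)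
    next
      case 3
      show ?thesis by (rule semi[of d b c]) (use 3 in auto)
    next
      case 4
      show ?thesis by (rule semi[of c b d]) (use 4 in auto)
    next
      case 5
      \<comment> \<open>\<open>cond_dagger\<close> requires a 5 among \<open>c\<close> and
        \<open>d\<close>, so the other one being 1, 2 or 5 gives exactly the exceptional
        sequences.\<close>
      then show ?thesis using exc' cond(5,6) by (auto simp: add_mset_commute)
    next
      case b: 6
      show ?thesis
      \<comment> \<open>One of \<open>c\<close>, \<open>d\<close> is 5. If 4 divides
        \<open>b\<close>, the roles change: \<open>b\<close> serves p_4 and \<open>a\<close>, as a
        multiple of 6, serves p_2 and p_3.\<close>
      proof (cases "4 dvd b")
        case True
        show ?thesis
        proof (cases "c = 5")
          case True
          then show ?thesis
            by (intro reg[OF regular_degree_sequence_4_odd[of c b a d]])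
              (use b a12 pos \<open>4 dvd b\<close> in \<open>auto intro: dvd_trans[of 6 12]\<close>)
        next
          case False
          then have "c = 1" "d = 5" using b cond(5) by auto
          then show ?thesis
            by (intro reg[OF regular_degree_sequence_4_odd[of d b a c]])
              (use b a12 pos \<open>4 dvd b\<close> in \<open>auto intro: dvd_trans[of 6 12]\<close>)
        qed
      next
        case False
        have "c = 5 \<or> d = 5" using b cond(5) by auto
        then show ?thesis
        proof
          assume "c = 5"
          then show ?thesis
            by (intro reg[OF regular_degree_sequence_4_5[of a b d]]) (use a12 r(2) pos False b in auto)
        next
          assume "d = 5"
          then show ?thesis
            by (intro reg[OF regular_degree_sequence_4_5[of a b c]]) (use a12 r(2) pos False b in auto)
        qed
      qed
    qed
  qed
qed

section \<open>Two and three variables, and the exceptional sequences\<close>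

lemma regular_degree_sequence_2_iff:
  assumes "a > 0" "b > 0"
  shows "regular_degree_sequence [a, b] \<longleftrightarrow> even a \<or> even b"
proof
  assume "regular_degree_sequence [a, b]"
  then show "even a \<or> even b"
    using regular_degree_sequence_dvd[of "[a, b]" 2] by simp
next
  have *: "regular_degree_sequence [p, q]" if "p > 0" "q > 0" "even q" for p q
    using that by (intro regular_degree_sequence_dvd_all) (auto simp: less_Suc_eq numeral_eq_Suc)
  assume "even a \<or> even b"
  then show "regular_degree_sequence [a, b]"
    using assms * regular_degree_sequence_mset[of "[b, a]" "[a, b]"]
    by (auto simp: add_mset_commute)
qed

lemma regular_degree_sequence_3_iff:
  assumes "a > 0" "b > 0" "c > 0"
  shows "regular_degree_sequence [a, b, c] \<longleftrightarrow> permissible [a, b, c]"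
proof
  assume reg: "regular_degree_sequence [a, b, c]"
  have "\<not> regular_degree_sequence [1, 1, d]" if "d > 0" for d
    using not_regular_degree_sequence_1_1[OF that] .
  then have "\<not> (a = 1 \<and> b = 1)" "\<not> (a = 1 \<and> c = 1)" "\<not> (b = 1 \<and> c = 1)"
    using assms reg regular_degree_sequence_mset[OF reg, of "[1, 1, a]"]
      regular_degree_sequence_mset[OF reg, of "[1, 1, b]"] by (auto simp: add_mset_commute)
  moreover have "even a \<or> even b \<or> even c"
    using regular_degree_sequence_dvd[OF reg, of 2] by simp
  moreover have "3 dvd a \<or> 3 dvd b \<or> 3 dvd c"
    using regular_degree_sequence_dvd[OF reg, of 3] by simp
  ultimately show "permissible [a, b, c]"
    unfolding permissible_3[OF assms] by blast
next
  have dvd: "regular_degree_sequence [p, q, r]"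
    if "p > 0" "q > 0" "r > 0" "even q" "3 dvd r" for p q r :: nat
    using that by (intro regular_degree_sequence_dvd_all) (auto simp: less_Suc_eq numeral_eq_Suc)
  have main: "regular_degree_sequence [x, y, z]"
    if pos: "x > 0" "y > 0" "z > 0" and p: "permissible [x, y, z]" and z: "3 dvd z" for x y z
  proof -
    note p = p[unfolded permissible_3[OF pos]]
    have "6 dvd z" if "even z"
      using that z by presburger
    \<comment> \<open>If \<open>z\<close> is the only even degree, it is a multiple of 6, and
      whichever of \<open>x\<close>, \<open>y\<close> is not 1 can carry the monomial in p_2 and
      p_3.\<close>
    then consider "even y" | "even x" | "6 dvd z" "x \<noteq> 1" | "6 dvd z" "y \<noteq> 1"
      using p by blast
    then show ?thesis
    proof cases
      case 1
      then show ?thesis using dvd pos z by blast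
    next
      case 2
      then show ?thesis
        using dvd[of y x z] pos z regular_degree_sequence_mset[of "[y, x, z]"]
        by (simp add: add_mset_commute)
    next
      case 3
      then show ?thesis
        using regular_degree_sequence_3[of x z y] pos regular_degree_sequence_mset[of "[y, x, z]"]
        by (simp add: add_mset_commute)
    next
      case 4
      then show ?thesis
        using regular_degree_sequence_3[of y z x] pos by simp
    qed
  qed
  assume perm: "permissible [a, b, c]"
  then consider "3 dvd c" | "3 dvd b" | "3 dvd a"
    unfolding permissible_3[OF assms] by blast
  then show "regular_degree_sequence [a, b, c]"
  proof cases
    case 1
    then show ?thesis using main assms perm by blast
  next
    case 2
    have "mset [a, c, b] = mset [a, b, c]" by (simp add: add_mset_commute)
    with 2 show ?thesis
      using main[of a c b] assms perm permissible_mset regular_degree_sequence_mset by blast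
  next
    case 3
    have "mset [b, c, a] = mset [a, b, c]" by (simp add: add_mset_commute)
    with 3 show ?thesis
      using main[of b c a] assms perm permissible_mset regular_degree_sequence_mset by blast
  qed
qed

lemma exceptional4_not_regular:
  assumes "exceptional4 ds"
  shows "\<not> regular_degree_sequence ds"
proof
  assume reg: "regular_degree_sequence ds"
  obtain x \<delta> where x: "x \<in> {1, 2, 5}" "\<delta> > 0" "mset ds = mset [x, 2, 5, 12 * \<delta>]"
    using assms unfolding exceptional4_def by auto
  then show False
    using regular_degree_sequence_mset[OF reg x(3)]
      not_regular_degree_sequence_1_2_5[of x 2 5 "12 * \<delta>"] by auto
qed

theorem theorem2p5:
  fixes ds :: "nat list"
  assumes "length ds \<in> {2, 3, 4}"
    and "\<forall>d\<in>set ds. d > 0"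
  shows "(length ds = 2 \<longrightarrow>
            (regular_degree_sequence ds \<longleftrightarrow> permissible ds) \<and>
            (permissible ds \<longleftrightarrow> cond_star ds))
       \<and> (length ds = 3 \<longrightarrow> (regular_degree_sequence ds \<longleftrightarrow> permissible ds))
       \<and> (length ds = 4 \<longrightarrow>
            (permissible ds \<and> \<not> exceptional4 ds \<longrightarrow> regular_degree_sequence ds) \<and>
            (exceptional4 ds \<longrightarrow> \<not> regular_degree_sequence ds))"
proof (intro conjI impI)
  assume "length ds = 2"
  then obtain a b where ds: "ds = [a, b]"
    by (auto simp: eval_nat_numeral length_Suc_conv)
  with assms(2) have "a > 0" "b > 0" by auto
  then show "regular_degree_sequence ds \<longleftrightarrow> permissible ds" "permissible ds \<longleftrightarrow> cond_star ds"
    by (simp_all add: ds regular_degree_sequence_2_iff permissible_2 cond_star_2)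
next
  assume "length ds = 3"
  then obtain a b c where ds: "ds = [a, b, c]"
    by (auto simp: eval_nat_numeral length_Suc_conv)
  with assms(2) show "regular_degree_sequence ds \<longleftrightarrow> permissible ds"
    by (simp add: regular_degree_sequence_3_iff)
next
  assume "length ds = 4" "permissible ds \<and> \<not> exceptional4 ds"
  then show "regular_degree_sequence ds"
    using regular_degree_sequence_4 assms(2) by blast
next
  assume "exceptional4 ds"
  then show "\<not> regular_degree_sequence ds"
    by (rule exceptional4_not_regular)
qed

end
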